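(* Let $A,B,E_1,E_2,F_1\in\mathbb{C}^{r\times r}$ be matrices such that $E_1F_1=F_1E_1$, $E_1E_2=E_2E_1$, $F_1+kI$ is invertible for all integers $k\ge0$, and $E_1$, $E_1-F_1+I$, $F_1-I$ are positive stable. Let $x>0$ be real and let $v\in\mathbb{C}$ be such that the three series defining the functions below converge. Then $${}_2E_1\left[(x,A,B;v)\,\Big|\begin{array}{c}E_1,E_2 \\ F_1\end{array}\right](E_1-F_1+I)={}_2E_1\left[(x,A,B;v)\,\Big|\begin{array}{c}E_1+I,E_2 \\ F_1\end{array}\right]E_1-{}_2E_1\left[(x,A,B;v)\,\Big|\begin{array}{c}E_1,E_2 \\ F_1-I\end{array}\right](F_1-I).$$
   Context: $\mathbb{C}^{r\times r}$ is the space of complex $r\times r$ matrices and $I$ is the identity matrix. A matrix $M$ is positive stable if every eigenvalue of $M$ has positive real part. For real $s>0$, $s^{M}=\exp(M\ln s)$. $\Gamma^{-1}(M)$ denotes the entire function $1/\Gamma(z)$ applied to $M$ by the matrix functional calculus (the matrix inverse of $\Gamma(M)=\int_0^\infty e^{-s}s^{M-I}ds$ when $M$ is positive stable). For $x>0$, $\Gamma(M,x)=\int_x^\infty e^{-s}s^{M-I}ds$ (convergent for every $M$ since $x>0$). The Pochhammer symbol is $(M)_0=I$, $(M)_m=M(M+I)\cdots(M+(m-1)I)$ for $m\ge1$, and $(M)_m^{-1}$ is its matrix inverse. The incomplete exponential matrix function ${}_2E_1$ is, with matrix products in the order written, $${}_2E_1\left[(x,A,B;v)\,\Big|\begin{array}{c}E_1,E_2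 \\ F_1\end{array}\right]=\sum_{m=0}^\infty \Gamma^{-1}(mA+B)\,\Gamma(mA+B,x)\,(E_1)_m(E_2)_m(F_1)_m^{-1}\frac{v^m}{m!}.$$ *)

theory Defs
  imports "HOL-Analysis.Analysis"
begin

text \<open>
  Square complex matrices of arbitrary size are elements of \<^typ>\<open>complex^'n^'n\<close>. On this type the
  class operations \<open>*\<close>, \<open>1\<close> and \<open>^\<close> are componentwise; the matrix product is \<open>**\<close> and the
  identity matrix is \<open>mat 1\<close>, so powers, exponentials and Pochhammer symbols are introduced anew.
\<close>

definition cmat_scale :: "complex \<Rightarrow> complex^'n^'n \<Rightarrow> complex^'n^'n" where
  "cmat_scale c M = (\<chi> i j. c * M $ i $ j)"

primrec mat_pow :: "complex^'n^'n \<Rightarrow> nat \<Rightarrow> complex^'n^'n" where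
  "mat_pow M 0 = mat 1"
| "mat_pow M (Suc k) = mat_pow M k ** M"

definition mat_eigenvalue :: "complex^'n^'n \<Rightarrow> complex \<Rightarrow> bool" where
  "mat_eigenvalue M l \<longleftrightarrow> (\<exists>w. w \<noteq> 0 \<and> M *v w = l *s w)"

definition positive_stable :: "complex^'n^'n \<Rightarrow> bool" where
  "positive_stable M \<longleftrightarrow> (\<forall>l. mat_eigenvalue M l \<longrightarrow> Re l > 0)"

definition mat_exp :: "complex^'n^'n \<Rightarrow> complex^'n^'n" where
  "mat_exp M = (\<Sum>k. (1 / fact k) *\<^sub>R mat_pow M k)"

text \<open>\<open>s\<^sup>M\<close> for real \<open>s > 0\<close>\<close>

definition mat_rpow :: "real \<Rightarrow> complex^'n^'n \<Rightarrow> complex^'n^'n" where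
  "mat_rpow s M = mat_exp (ln s *\<^sub>R M)"

text \<open>
  The functional calculus for entire functions: the Taylor series of \<open>f\<close> at \<open>0\<close>, evaluated at a
  matrix. It is meaningful only for entire \<open>f\<close>, for which the series converges for every matrix.
\<close>

definition mat_entire_fun :: "(complex \<Rightarrow> complex) \<Rightarrow> complex^'n^'n \<Rightarrow> complex^'n^'n" where
  "mat_entire_fun f M = (\<Sum>k. cmat_scale ((deriv ^^ k) f 0 / fact k) (mat_pow M k))"

text \<open>\<^const>\<open>rGamma\<close> is the entire function \<open>1/\<Gamma>\<close>.\<close>

definition mat_rGamma :: "complex^'n^'n \<Rightarrow> complex^'n^'n" where
  "mat_rGamma M = mat_entire_fun rGamma M"

definition mat_inc_Gamma :: "complex^'n^'n \<Rightarrow> real \<Rightarrow> complex^'n^'n" where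
  "mat_inc_Gamma M x = (LINT s:{x..}|lborel. exp (- s) *\<^sub>R mat_rpow s (M - mat 1))"

primrec mat_pochhammer :: "complex^'n^'n \<Rightarrow> nat \<Rightarrow> complex^'n^'n" where
  "mat_pochhammer M 0 = mat 1"
| "mat_pochhammer M (Suc m) = mat_pochhammer M m ** (M + of_nat m *\<^sub>R mat 1)"

definition inc_E21_term ::
  "real \<Rightarrow> complex^'n^'n \<Rightarrow> complex^'n^'n \<Rightarrow> complex \<Rightarrow>
   complex^'n^'n \<Rightarrow> complex^'n^'n \<Rightarrow> complex^'n^'n \<Rightarrow> nat \<Rightarrow> complex^'n^'n" where
  "inc_E21_term x A B v E1 E2 F1 m =
     cmat_scale (v ^ m / fact m)
       (mat_rGamma (of_nat m *\<^sub>R A + B) ** mat_inc_Gamma (of_nat m *\<^sub>R A + B) x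
        ** mat_pochhammer E1 m ** mat_pochhammer E2 m ** matrix_inv (mat_pochhammer F1 m))"

definition inc_E21 ::
  "real \<Rightarrow> complex^'n^'n \<Rightarrow> complex^'n^'n \<Rightarrow> complex \<Rightarrow>
   complex^'n^'n \<Rightarrow> complex^'n^'n \<Rightarrow> complex^'n^'n \<Rightarrow> complex^'n^'n" where
  "inc_E21 x A B v E1 E2 F1 = (\<Sum>m. inc_E21_term x A B v E1 E2 F1 m)"

end

theory Submission
  imports Defs
begin

text \<open>
  The identity holds term by term. The common prefix
  \<open>\<Gamma>\<^sup>-\<^sup>1(mA + B) \<Gamma>(mA + B, x) (E1)\<^sub>m (E2)\<^sub>m (F1)\<^sub>m\<^sup>-\<^sup>1\<close> is multiplied on the right
  by \<open>E1 + m I\<close> in the first series of the right-hand side, since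
  \<open>(E1 + I)\<^sub>m E1 = (E1)\<^sub>m (E1 + m I)\<close>, and by \<open>F1 - I + m I\<close> in the second, since
  \<open>(F1 - I) (F1)\<^sub>m = (F1 - I)\<^sub>m (F1 - I + m I)\<close>; the difference of these factors does not
  depend on \<open>m\<close>.
\<close>

lemma matrix_add_rdistrib: "(X + Y) ** Z = X ** Z + Y ** Z"
  by (simp add: matrix_matrix_mult_def vec_eq_iff distrib_right sum.distrib)

lemma matrix_diff_ldistrib: "X ** (Y - Z) = X ** Y - X ** (Z::'a::ring_1^'n^'m)"
  by (simp add: matrix_matrix_mult_def vec_eq_iff right_diff_distrib sum_subtractf)

lemma
  assumes "invertible P"
  shows matrix_inv_right: "P ** matrix_inv P = mat 1"
    and matrix_inv_left: "matrix_inv P ** P = mat 1"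
  using assms someI_ex[of "\<lambda>Q. P ** Q = mat 1 \<and> Q ** P = mat 1"]
  by (simp_all add: invertible_def matrix_inv_def)

lemma matrix_mul_commute_inv:
  fixes X P :: "complex^'n^'n"
  assumes "invertible P" "X ** P = P ** X"
  shows "X ** matrix_inv P = matrix_inv P ** X"
proof -
  have "X ** matrix_inv P = matrix_inv P ** (P ** X) ** matrix_inv P"
    by (simp add: matrix_mul_assoc matrix_inv_left[OF assms(1)])
  also have "\<dots> = matrix_inv P ** X ** (P ** matrix_inv P)"
    by (simp only: assms(2)[symmetric] matrix_mul_assoc)
  finally show ?thesis
    by (simp add: matrix_inv_right[OF assms(1)])
qed

lemma commute_shift:
  fixes X M :: "complex^'n^'n"
  assumes "X ** M = M ** X"
  shows "X ** (M + c *\<^sub>R mat 1) = (M + c *\<^sub>R mat 1) ** X"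
  by (simp add: matrix_add_ldistrib matrix_add_rdistrib assms
      matrix_scalar_ac scalar_matrix_assoc[symmetric])

lemma commute_pochhammer:
  fixes X M :: "complex^'n^'n"
  assumes "X ** M = M ** X"
  shows "X ** mat_pochhammer M m = mat_pochhammer M m ** X"
proof (induction m)
  case (Suc m)
  have "X ** mat_pochhammer M (Suc m) = mat_pochhammer M m ** (X ** (M + of_nat m *\<^sub>R mat 1))"
    by (simp add: matrix_mul_assoc Suc.IH)
  then show ?case
    by (simp add: matrix_mul_assoc commute_shift[OF assms])
qed simp

text \<open>Both sides are the product of \<open>M\<close>, \<open>M + I\<close>, ...,
  \<open>M + m I\<close>, that is \<open>mat_pochhammer M (Suc m)\<close>, with \<open>M\<close>
  split off at one end and \<open>M + m I\<close> at the other.\<close>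

lemma pochhammer_shift:
  fixes M :: "complex^'n^'n"
  shows "mat_pochhammer (M + mat 1) m ** M = mat_pochhammer M m ** (M + of_nat m *\<^sub>R mat 1)"
proof (induction m)
  case (Suc m)
  have shift: "M + mat 1 + of_nat m *\<^sub>R mat 1 = M + of_nat (Suc m) *\<^sub>R mat 1"
    by (simp add: scaleR_left_distrib)
  have "mat_pochhammer (M + mat 1) (Suc m) ** M
      = mat_pochhammer (M + mat 1) m ** ((M + of_nat (Suc m) *\<^sub>R mat 1) ** M)"
    by (simp only: mat_pochhammer.simps shift matrix_mul_assoc)
  \<comment> \<open>\<open>M\<close> commutes with itself (\<open>refl\<close>), hence with its
    shifts; it moves left to meet the product to which the induction hypothesis applies.\<close>
  also have "\<dots> = mat_pochhammer (M + mat 1) m ** M ** (M + of_nat (Suc m) *\<^sub>R mat 1)"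
    by (simp only: commute_shift[OF refl, symmetric] matrix_mul_assoc)
  also have "\<dots> = mat_pochhammer M (Suc m) ** (M + of_nat (Suc m) *\<^sub>R mat 1)"
    by (simp only: Suc.IH mat_pochhammer.simps)
  finally show ?case .
qed simp

lemma invertible_pochhammer:
  fixes M :: "complex^'n^'n"
  assumes "\<And>k::nat. invertible (M + of_nat k *\<^sub>R mat 1)"
  shows "invertible (mat_pochhammer M m)"
proof (induction m)
  case 0
  show ?case
    by (auto simp: invertible_def intro: exI[of _ "mat 1"])
next
  case (Suc m)
  then show ?case
    by (simp add: invertible_mult assms)
qed

text \<open>Rearranges \<open>pochhammer_shift\<close>: with \<open>P\<close>, \<open>Q\<close>,
  \<open>K\<close> as in the proof, \<open>M ** P = P ** M = Q ** K\<close>, so \<open>Q\<close> can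
  be cancelled on the left and \<open>P\<close> on the right. For \<open>M = F1 - mat 1\<close>,
  \<open>P\<close> is the Pochhammer symbol of \<open>F1\<close>.\<close>

lemma pochhammer_shift_inv:
  fixes M :: "complex^'n^'n"
  assumes inv: "\<And>k::nat. invertible (M + of_nat k *\<^sub>R mat 1)"
  shows "matrix_inv (mat_pochhammer M m) ** M
       = matrix_inv (mat_pochhammer (M + mat 1) m) ** (M + of_nat m *\<^sub>R mat 1)"
proof -
  let ?P = "mat_pochhammer (M + mat 1) m" and ?Q = "mat_pochhammer M m"
    and ?K = "M + of_nat m *\<^sub>R mat 1"
  have "invertible (M + mat 1 + of_nat k *\<^sub>R mat 1)" for k :: nat
    using inv[of "Suc k"] by (simp add: scaleR_left_distrib add.assoc)
  then have P: "invertible ?P"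
    by (rule invertible_pochhammer)
  have Q: "invertible ?Q"
    using inv by (rule invertible_pochhammer)
  have M: "M ** (M + mat 1) = (M + mat 1) ** M"
    using commute_shift[OF refl, of M 1] by simp
  have "?K ** (M + mat 1) = (M + mat 1) ** ?K"
    by (rule commute_shift[OF M[symmetric], symmetric])
  then have KP: "?K ** matrix_inv ?P = matrix_inv ?P ** ?K"
    by (intro matrix_mul_commute_inv P commute_pochhammer)
  \<comment> \<open>Insert \<open>P ** matrix_inv P = mat 1\<close> to make
    \<open>pochhammer_shift\<close> applicable.\<close>
  have "matrix_inv ?Q ** M = matrix_inv ?Q ** (M ** ?P) ** matrix_inv ?P"
    by (simp only: matrix_mul_assoc[symmetric] matrix_inv_right[OF P] matrix_mul_rid)
  also have "\<dots> = matrix_inv ?Q ** ?Q ** ?K ** matrix_inv ?P"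
    by (simp only: commute_pochhammer[OF M] pochhammer_shift matrix_mul_assoc)
  finally show ?thesis
    by (simp add: matrix_inv_left[OF Q] KP)
qed

text \<open>A nonzero kernel vector would be an eigenvector for the eigenvalue 0, whose real part is
  not positive.\<close>

lemma positive_stable_imp_invertible:
  assumes "positive_stable M"
  shows "invertible M"
proof -
  have "w = 0" if "M *v w = 0" for w
    using assms that unfolding positive_stable_def mat_eigenvalue_def
    by (metis less_irrefl vector_smult_lzero zero_complex.simps(1))
  then show ?thesis
    by (simp add: invertible_left_inverse matrix_left_invertible_ker)
qed

lemma cmat_scale_mult_right: "cmat_scale c (X ** Y) = cmat_scale c X ** Y"
  by (simp add: cmat_scale_def matrix_matrix_mult_def vec_eq_iff sum_distrib_left mult.assoc)

text \<open>Linear maps in finite dimension are bounded; this lets a right factor be multiplied into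
  a convergent series term by term.\<close>

lemma bounded_linear_matrix_mult_right: "bounded_linear (\<lambda>X::complex^'n^'n. X ** Y)"
  by (intro linear_conv_bounded_linear[THEN iffD1] linearI)
    (simp_all add: matrix_add_rdistrib scalar_matrix_assoc)

lemma inc_E21_term_contiguous:
  fixes A B E1 E2 F1 :: "complex^'n^'n"
  assumes EF: "E1 ** F1 = F1 ** E1"
    and EE: "E1 ** E2 = E2 ** E1"
    and inv: "\<And>k::nat. invertible (F1 - mat 1 + of_nat k *\<^sub>R mat 1)"
  shows "inc_E21_term x A B v E1 E2 F1 m ** (E1 - F1 + mat 1) =
         inc_E21_term x A B v (E1 + mat 1) E2 F1 m ** E1
         - inc_E21_term x A B v E1 E2 (F1 - mat 1) m ** (F1 - mat 1)"
proof -
  define G where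
    "G = mat_rGamma (of_nat m *\<^sub>R A + B) ** mat_inc_Gamma (of_nat m *\<^sub>R A + B) x"
  define T where
    "T = G ** mat_pochhammer E1 m ** mat_pochhammer E2 m ** matrix_inv (mat_pochhammer F1 m)"
  define K where "K = E1 + of_nat m *\<^sub>R mat 1"
  define L where "L = F1 - mat 1 + of_nat m *\<^sub>R mat 1"
  have "invertible (F1 + of_nat k *\<^sub>R mat 1)" for k :: nat
    using inv[of "Suc k"] by (simp add: scaleR_left_distrib)
  then have "invertible (mat_pochhammer F1 m)"
    by (rule invertible_pochhammer)
  \<comment> \<open>Used twice: \<open>X = E1\<close> moves left past this block to reach the
    shifted Pochhammer symbol, and the resulting \<open>X = K\<close> moves back to the right
    end.\<close>
  then have comm: "X ** (mat_pochhammer E2 m ** matrix_inv (mat_pochhammer F1 m))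
      = mat_pochhammer E2 m ** matrix_inv (mat_pochhammer F1 m) ** X"
    if "X ** E2 = E2 ** X" "X ** F1 = F1 ** X" for X
    using that
    by (metis matrix_mul_assoc matrix_mul_commute_inv commute_pochhammer)
  have K: "K ** E2 = E2 ** K" "K ** F1 = F1 ** K"
    unfolding K_def by (simp_all add: commute_shift EE EF)
  have "G ** mat_pochhammer (E1 + mat 1) m ** mat_pochhammer E2 m
        ** matrix_inv (mat_pochhammer F1 m) ** E1
      = G ** (mat_pochhammer (E1 + mat 1) m ** E1)
        ** (mat_pochhammer E2 m ** matrix_inv (mat_pochhammer F1 m))"
    by (simp only: matrix_mul_assoc[symmetric] comm[OF EE EF, unfolded matrix_mul_assoc[symmetric]])
  also have "\<dots> = T ** K"
    by (simp only: pochhammer_shift K_def[symmetric] T_def matrix_mul_assoc[symmetric]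
        comm[OF K, unfolded matrix_mul_assoc[symmetric]])
  finally have E: "G ** mat_pochhammer (E1 + mat 1) m ** mat_pochhammer E2 m
        ** matrix_inv (mat_pochhammer F1 m) ** E1 = T ** K" .
  \<comment> \<open>Here \<open>F1 - mat 1\<close> already stands next to the inverse symbol, so no
    factor has to pass another.\<close>
  have F: "G ** mat_pochhammer E1 m ** mat_pochhammer E2 m
        ** matrix_inv (mat_pochhammer (F1 - mat 1) m) ** (F1 - mat 1) = T ** L"
    using pochhammer_shift_inv[OF inv, of m]
    by (simp add: T_def L_def flip: matrix_mul_assoc)
  have "E1 - F1 + mat 1 = K - L"
    by (simp add: K_def L_def)
  then have "cmat_scale c T ** (E1 - F1 + mat 1) = cmat_scale c T ** K - cmat_scale c T ** L" for c
    by (simp only: matrix_diff_ldistrib)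
  then show ?thesis
    unfolding inc_E21_term_def G_def[symmetric] T_def[symmetric]
    by (simp only: cmat_scale_mult_right[symmetric] E F)
qed

theorem theorem5p10:
  fixes A B E1 E2 F1 :: "complex^'n^'n" and x :: real and v :: complex
  assumes "E1 ** F1 = F1 ** E1"
    and "E1 ** E2 = E2 ** E1"
    and "\<And>k::nat. invertible (F1 + of_nat k *\<^sub>R mat 1)"
    and "positive_stable E1"
    and "positive_stable (E1 - F1 + mat 1)"
    and "positive_stable (F1 - mat 1)"
    and "x > 0"
    and "summable (inc_E21_term x A B v E1 E2 F1)"
    and "summable (inc_E21_term x A B v (E1 + mat 1) E2 F1)"
    and "summable (inc_E21_term x A B v E1 E2 (F1 - mat 1))"
  shows "inc_E21 x A B v E1 E2 F1 ** (E1 - F1 + mat 1) =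
         inc_E21 x A B v (E1 + mat 1) E2 F1 ** E1
         - inc_E21 x A B v E1 E2 (F1 - mat 1) ** (F1 - mat 1)"
proof -
  have inv: "invertible (F1 - mat 1 + of_nat k *\<^sub>R mat 1)" for k :: nat
  \<comment> \<open>For \<open>k = 0\<close> the matrix is \<open>F1 - mat 1\<close>, invertible by
    positive stability; for \<open>k = Suc j\<close> it is \<open>F1 + j I\<close>.\<close>
  proof (cases k)
    case 0
    then show ?thesis
      using positive_stable_imp_invertible[OF assms(6)] by simp
  next
    case (Suc j)
    then show ?thesis
      using assms(3)[of j] by (simp add: scaleR_left_distrib)
  qed
  note sums = bounded_linear.sums[OF bounded_linear_matrix_mult_right summable_sums]
  \<comment> \<open>The same series is summed in two ways, and uniqueness of its limit gives the
    identity.\<close>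
  have "(\<lambda>m. inc_E21_term x A B v E1 E2 F1 m ** (E1 - F1 + mat 1)) sums
      (inc_E21 x A B v (E1 + mat 1) E2 F1 ** E1
         - inc_E21 x A B v E1 E2 (F1 - mat 1) ** (F1 - mat 1))"
    unfolding inc_E21_term_contiguous[OF assms(1,2) inv] inc_E21_def
    by (intro sums_diff sums assms(9,10))
  moreover have "(\<lambda>m. inc_E21_term x A B v E1 E2 F1 m ** (E1 - F1 + mat 1)) sums
      (inc_E21 x A B v E1 E2 F1 ** (E1 - F1 + mat 1))"
    unfolding inc_E21_def by (intro sums assms(8))
  ultimately show ?thesis
    by (rule sums_unique2[symmetric])
qed

end
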